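(* For any natural number $n\geq 1$ and any partition $\mathcal P$ of $[\omega]^n$ there is a finite partition $\mathcal Q$ of $[\omega]^{2n}$ such that any set $X\subseteq \omega$ that is homogeneous for $\mathcal Q$ is a finite union of sets that are canonical for $\mathcal P$.
   Context: Natural numbers are identified with finite ordinals, so $n=\{0,1,\dots,n-1\}$, and $\omega$ is the set of all natural numbers. For a set $X$ and $n\in\omega$, $[X]^n=\{\bm x\subseteq X: |\bm x|=n\}$. A set $\mathcal P\subseteq\mathscr P(Z)$ is a partition of a set $Z$ if $\bigcup\mathcal P=Z$ and any two distinct elements of $\mathcal P$ are disjoint (one of the elements of a partition is allowed to be empty). $\mathcal P$ may be infinite; a partition is finite if it has finitely many elements. For a partition $\mathcal P$ of $Z$ and $x,y\in Z$, $x\approx_{\mathcal P}y$ means that there is $P\in\mathcal P$ with $x,y\in P$. For a partition $\mathcal Q$ of $[\omega]^k$, a set $Y\subseteq\omega$ is homogeneous for $\mathcal Q$ if there is $P\in\mathcal Q$ with $[Y]^k\subseteq P$. For $X\subseteq\omega$ and $i<|X|$, $X_{[i]}$ denotes the $i$-th element of $X$ in the natural ordering (counting from $0$), i.e. the $x\in X$ with $|\{y\in X:y<x\}|=i$. Let $\mathcal P$ be a partition of $[\omega]^n$, $1\le n<\omega$, and $I\subseteq n$. A set $X\subseteq\omega$ is $I$-canonical for $\mathcal P$ if for all $\bm p,\bm q\in[X]^n$: $\bm p\approx_{\mathcal P}\bm q$ if and only if $\bm p_{[i]}=\bm q_{[i]}$ for all $i\in I$. A set $X\subseteq\omega$ is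 canonical for $\mathcal P$ if it is $I$-canonical for $\mathcal P$ for some $I\subseteq n$. *)

theory Defs
  imports "HOL-Library.Ramsey" "HOL-Library.Infinite_Set" "HOL-Library.Disjoint_Sets"
begin

(* Unlike partition_on, an empty part is permitted. *)
definition weak_partition_on :: "'a set \<Rightarrow> 'a set set \<Rightarrow> bool" where
  "weak_partition_on Z P \<longleftrightarrow> \<Union>P = Z \<and> disjoint P"

definition same_part :: "'a set set \<Rightarrow> 'a \<Rightarrow> 'a \<Rightarrow> bool" where
  "same_part P x y \<longleftrightarrow> (\<exists>A\<in>P. x \<in> A \<and> y \<in> A)"

definition homogeneous_for :: "nat \<Rightarrow> nat set set set \<Rightarrow> nat set \<Rightarrow> bool" where
  "homogeneous_for k Q Y \<longleftrightarrow> (\<exists>A\<in>Q. [Y]\<^bsup>k\<^esup> \<subseteq> A)"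

(* The i-th element of a set X of naturals in increasing order, counting from 0, is
   enumerate X i.  For finite X this is meaningful when i < card X, as the next lemma records. *)
lemma enumerate_eq_iff_card_less:
  fixes X :: "nat set"
  assumes "finite X" "i < card X"
  shows "enumerate X i = x \<longleftrightarrow> x \<in> X \<and> card {y \<in> X. y < x} = i"
proof -
  have enum: "card {y \<in> X. y < enumerate X j} = j" if "j < card X" for j
  proof -
    have "{y \<in> X. y < enumerate X j} = enumerate X ` {..<j}"
    proof (intro equalityI subsetI)
      fix y assume y: "y \<in> {y \<in> X. y < enumerate X j}"
      then obtain m where m: "m < card X" "enumerate X m = y"
        using finite_enumerate_Ex[OF assms(1)] by blast
      then have "m < j"
        using y m that assms(1) finite_enumerate_mono_iff by blast
      then show "y \<in> enumerate X ` {..<j}"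
        using m by blast
    next
      fix y assume "y \<in> enumerate X ` {..<j}"
      then obtain m where m: "m < j" "y = enumerate X m"
        by blast
      then show "y \<in> {y \<in> X. y < enumerate X j}"
        using that finite_enumerate_in_set[OF assms(1), of m]
          finite_enumerate_mono[OF m(1) assms(1) that] by simp
    qed
    moreover have "inj_on (enumerate X) {..<j}"
      using finite_bij_enumerate[OF assms(1)] that
      by (meson bij_betw_imp_inj_on inj_on_subset lessThan_subset_iff less_imp_le)
    ultimately show ?thesis
      by (simp add: card_image)
  qed
  show ?thesis
  proof
    assume "enumerate X i = x"
    then show "x \<in> X \<and> card {y \<in> X. y < x} = i"
      using enum[OF assms(2)] finite_enumerate_in_set[OF assms] by blast
  next
    assume x: "x \<in> X \<and> card {y \<in> X. y < x} = i"
    then obtain m where m: "m < card X" "enumerate X m = x"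
      using finite_enumerate_Ex[OF assms(1)] by blast
    have "m = i"
      using x enum[OF m(1)] m(2) by simp
    then show "enumerate X i = x"
      using m(2) by simp
  qed
qed

definition I_canonical :: "nat \<Rightarrow> nat set set set \<Rightarrow> nat set \<Rightarrow> nat set \<Rightarrow> bool" where
  "I_canonical n P I X \<longleftrightarrow>
     (\<forall>p \<in> [X]\<^bsup>n\<^esup>. \<forall>q \<in> [X]\<^bsup>n\<^esup>.
        same_part P p q \<longleftrightarrow> (\<forall>i\<in>I. enumerate p i = enumerate q i))"

definition canonical :: "nat \<Rightarrow> nat set set set \<Rightarrow> nat set \<Rightarrow> bool" where
  "canonical n P X \<longleftrightarrow> (\<exists>I \<subseteq> {..<n}. I_canonical n P I X)"

end

theory Submission
  imports Defs
begin

text \<open>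
  Colour a \<open>2n\<close>-set \<open>s\<close> by its pattern: the set of all pairs of index sets \<open>A\<close>, \<open>B\<close> such that the
  subsets of \<open>s\<close> at the places \<open>A\<close> and \<open>B\<close> lie in a common part of \<open>P\<close>. There are finitely many
  patterns, and \<open>Q\<close> consists of their fibres. A finite set is the union of its singletons, which are
  trivially canonical. An infinite homogeneous set turns out to be canonical itself.

  Indeed, let \<open>X\<close> be infinite with all its \<open>2n\<close>-subsets of the same pattern. If \<open>p\<close> and \<open>q\<close> are
  \<open>n\<close>-subsets of \<open>X\<close>, then \<open>p \<union> q\<close> has at most \<open>2n\<close> elements, and it can be completed to a
  \<open>2n\<close>-subset of \<open>X\<close> by elements \<^emph>\<open>above\<close> it, so that the places of \<open>p\<close> and \<open>q\<close> are determined by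
  \<open>p \<union> q\<close> alone. Therefore, whether \<open>p\<close> and \<open>q\<close> are equivalent depends only on how the elements of
  \<open>p\<close> compare with those of \<open>q\<close> (\<open>homogeneous_imp_position_invariant\<close>).

  Because of this invariance, \<open>X\<close> may be replaced by \<open>\<omega>\<close>, and the argument of Erdos and Rado applies.
  Call a coordinate \<open>i\<close> free if a change of that coordinate alone can preserve the class; by
  invariance it then always does. Let \<open>I\<close> be the set of coordinates that are not free. Two increasing
  sequences that agree on \<open>I\<close> are equivalent, since their pointwise minimum can be raised to either
  of them one free coordinate at a time (\<open>equivalent_if_agree\<close>). Conversely, equivalent sequences
  agree on \<open>I\<close>: at the least place \<open>i\<close> of disagreement in \<open>I\<close>, the smaller of the two values can be
  shifted slightly without altering its comparison with the other sequence, which would make \<open>i\<close>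
  free (\<open>not_equivalent_if_less\<close>).
\<close>

section \<open>Relative position of increasing sequences\<close>

abbreviation increasing :: "nat \<Rightarrow> (nat \<Rightarrow> nat) \<Rightarrow> bool" where
  "increasing n a \<equiv> strict_mono_on {..<n} a"

definition same_position ::
    "nat \<Rightarrow> (nat \<Rightarrow> nat) \<Rightarrow> (nat \<Rightarrow> nat) \<Rightarrow> (nat \<Rightarrow> nat) \<Rightarrow> (nat \<Rightarrow> nat) \<Rightarrow> bool" where
  "same_position n a b a' b' \<longleftrightarrow>
     (\<forall>j<n. \<forall>k<n. (a j < b k \<longleftrightarrow> a' j < b' k) \<and> (b k < a j \<longleftrightarrow> b' k < a' j))"

lemma same_position_swap: "same_position n a b a' b' \<Longrightarrow> same_position n b a b' a'"
  by (auto simp: same_position_def)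

lemma increasingD: "increasing n a \<Longrightarrow> j < k \<Longrightarrow> k < n \<Longrightarrow> a j < a k"
  by (auto simp: strict_mono_on_def)

lemma increasing_less_iff:
  "increasing n a \<Longrightarrow> j < n \<Longrightarrow> k < n \<Longrightarrow> a j < a k \<longleftrightarrow> j < k"
  by (metis increasingD less_asym' linorder_neqE_nat)

lemma increasing_inj_on: "increasing n a \<Longrightarrow> inj_on a {..<n}"
  by (rule strict_mono_on_imp_inj_on)

lemma same_position_update:
  assumes a: "increasing n a" "increasing n (a(i := x))" "a i < x"
    and b: "increasing n b" "increasing n (b(i := y))" "b i < y"
    and i: "i < n"
  shows "same_position n a (a(i := x)) b (b(i := y))"
  unfolding same_position_def
proof (intro allI impI)
  \<comment> \<open>The inserted value \<open>x\<close> lies between \<open>c i\<close> and \<open>c (i + 1)\<close>, so it is compared by index.\<close>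
  have below: "c j < x \<longleftrightarrow> j \<le> i" "x < c j \<longleftrightarrow> i < j"
    if c: "increasing n c" "increasing n (c(i := x))" "c i < x" and j: "j < n" for c j x
  proof -
    have "j < i \<Longrightarrow> c j < c i" using increasingD[OF c(1)] i by simp
    moreover have "i < j \<Longrightarrow> x < c j" using increasingD[OF c(2), of i j] j by simp
    ultimately show "c j < x \<longleftrightarrow> j \<le> i" "x < c j \<longleftrightarrow> i < j"
      using c(3) by (metis le_less_linear le_neq_implies_less less_asym' less_trans)+
  qed
  fix j k assume jk: "j < n" "k < n"
  show "(a j < (a(i := x)) k \<longleftrightarrow> b j < (b(i := y)) k) \<and>
        ((a(i := x)) k < a j \<longleftrightarrow> (b(i := y)) k < b j)"
    using below[OF a jk(1)] below[OF b jk(1)]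
      increasing_less_iff[OF a(1) jk] increasing_less_iff[OF b(1) jk]
      increasing_less_iff[OF a(1) jk(2,1)] increasing_less_iff[OF b(1) jk(2,1)] by simp
qed

section \<open>Equivalence relations that are invariant under relative position\<close>

locale position_invariant_equivalence =
  fixes n :: nat and R :: "(nat \<Rightarrow> nat) \<Rightarrow> (nat \<Rightarrow> nat) \<Rightarrow> bool"
  assumes refl: "increasing n a \<Longrightarrow> R a a"
    and sym: "R a b \<Longrightarrow> R b a"
    and trans: "R a b \<Longrightarrow> R b c \<Longrightarrow> R a c"
    and invariant: "\<lbrakk>increasing n a; increasing n b; increasing n a'; increasing n b';
        same_position n a b a' b'; R a b\<rbrakk> \<Longrightarrow> R a' b'"
begin

definition free :: "nat \<Rightarrow> bool" where
  "free i \<longleftrightarrow> i < n \<and>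
     (\<exists>a x. increasing n a \<and> increasing n (a(i := x)) \<and> a i \<noteq> x \<and> R a (a(i := x)))"

lemma free_ascending:
  assumes "free i"
  obtains a x where "increasing n a" "increasing n (a(i := x))" "a i < x" "R a (a(i := x))"
proof -
  obtain a x where ax: "increasing n a" "increasing n (a(i := x))" "a i \<noteq> x" "R a (a(i := x))"
    using assms by (auto simp: free_def)
  show thesis
  proof (cases "a i < x")
    case True
    then show thesis using that ax by blast
  next
    case False
    then show thesis using that[of "a(i := x)" "a i"] ax sym by simp
  qed
qed

text \<open>All pairs that differ in coordinate \<open>i\<close> only, in the same direction, have the same relative
  position, so one witness of freeness speaks for all of them.\<close>

lemma free_update:
  assumes "free i" "increasing n b" "increasing n (b(i := y))" "b i \<le> y"
  shows "R b (b(i := y))"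
proof (cases "b i = y")
  case True
  then show ?thesis using refl assms(2) by (simp add: fun_upd_idem)
next
  case False
  obtain a x where "increasing n a" "increasing n (a(i := x))" "a i < x" "R a (a(i := x))"
    using free_ascending[OF assms(1)] .
  then show ?thesis
    using invariant same_position_update assms False
    by (metis free_def le_neq_implies_less)
qed

text \<open>Coordinates are raised from the top down: that way every intermediate sequence, which follows
  \<open>r\<close> below some \<open>m\<close> and \<open>p\<close> from \<open>m\<close> on, is increasing.\<close>

lemma equivalent_if_raised:
  assumes r: "increasing n r" and p: "increasing n p"
    and le: "\<And>j. j < n \<Longrightarrow> r j \<le> p j"
    and agree: "\<And>j. j < n \<Longrightarrow> \<not> free j \<Longrightarrow> r j = p j"
  shows "R r p"
proof -
  define c where "c m = (\<lambda>j. if j < m then r j else p j)" for m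
  have inc: "increasing n (c m)" for m
  proof (rule strict_mono_onI)
    fix j k assume jk: "j \<in> {..<n}" "k \<in> {..<n}" "j < k"
    show "c m j < c m k"
      using increasingD[OF r jk(3)] increasingD[OF p jk(3)] le[of k] jk
      by (auto simp: c_def)
  qed
  have "R (c m) p" if "m \<le> n" for m
    using that
  proof (induction m)
    case 0
    then show ?case using refl[OF p] by (simp add: c_def)
  next
    case (Suc m)
    have eq: "c m = (c (Suc m))(m := p m)"
      by (auto simp: c_def)
    have "R (c (Suc m)) (c m)"
    proof (cases "free m")
      case True
      then show ?thesis
        using free_update[OF True inc, of "Suc m" "p m"] inc[of m] le[of m] Suc.prems eq
        by (simp add: c_def)
    next
      case False
      then have "c (Suc m) = c m"
        using agree[of m] Suc.prems by (auto simp: c_def less_Suc_eq)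
      then show ?thesis using refl[OF inc] by simp
    qed
    then show ?case using Suc trans by simp
  qed
  then have "R (c n) p" by simp
  moreover have "same_position n (c n) p r p"
    by (simp add: same_position_def c_def)
  ultimately show ?thesis
    using invariant inc r p by blast
qed

lemma equivalent_if_agree:
  assumes p: "increasing n p" and q: "increasing n q"
    and agree: "\<And>j. j < n \<Longrightarrow> \<not> free j \<Longrightarrow> p j = q j"
  shows "R p q"
proof -
  define r where "r = (\<lambda>j. min (p j) (q j))"
  have "increasing n r"
  proof (rule strict_mono_onI)
    fix j k assume jk: "j \<in> {..<n}" "k \<in> {..<n}" "j < k"
    show "r j < r k"
      using increasingD[OF p jk(3)] increasingD[OF q jk(3)] jk by (auto simp: r_def)
  qed
  then have "R r p" "R r q"
    using equivalent_if_raised p q agree by (auto simp: r_def)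
  then show ?thesis using sym trans by blast
qed

text \<open>The values are first spread out to \<open>3 * p j + 1\<close> and \<open>3 * q j + 1\<close>, to make room next to each
  of them. If \<open>p i\<close> also occurs in \<open>q\<close>, then it does so at a place \<open>j < i\<close>, because \<open>p i < q i\<close>. This
  place is free, since otherwise \<open>p j = q j = p i\<close>; hence this occurrence can be moved up by one. After that, the entry of \<open>p\<close> at \<open>i\<close> can be moved down
  by one without passing or leaving any entry of \<open>q\<close>, so that \<open>i\<close> would be free.\<close>

lemma not_equivalent_if_less:
  assumes p: "increasing n p" and q: "increasing n q"
    and i: "i < n" "\<not> free i" "p i < q i"
    and agree: "\<And>j. j < i \<Longrightarrow> \<not> free j \<Longrightarrow> p j = q j"
  shows "\<not> R p q"
proof
  assume "R p q"
  define p0 q0 where "p0 = (\<lambda>j. 3 * p j + 1)" and "q0 = (\<lambda>j. 3 * q j + 1)"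
  define q1 where "q1 = (\<lambda>j. if q j = p i then 3 * q j + 2 else 3 * q j + 1)"
  define p1 where "p1 = p0(i := 3 * p i)"
  have inc: "increasing n p0" "increasing n q0" "increasing n q1" "increasing n p1"
  proof -
    have "p0 j < p0 k \<and> q0 j < q0 k \<and> q1 j < q1 k \<and> p1 j < p1 k" if jk: "j < k" "k < n" for j k
    proof -
      have "p j < p k" "q j < q k"
        using increasingD[OF p jk] increasingD[OF q jk] by simp_all
      then have "q1 j < q1 k" "p1 j < p1 k"
        by (auto simp: q1_def p1_def p0_def)
      with \<open>p j < p k\<close> \<open>q j < q k\<close> show ?thesis by (simp add: p0_def q0_def)
    qed
    then show "increasing n p0" "increasing n q0" "increasing n q1" "increasing n p1"
      by (simp_all add: strict_mono_on_def)
  qed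
  have "same_position n p q p0 q0"
    by (auto simp: same_position_def p0_def q0_def)
  then have "R p0 q0"
    using invariant p q inc \<open>R p q\<close> by blast
  moreover have "R q0 q1"
  proof (rule equivalent_if_agree)
    fix j assume j: "j < n" "\<not> free j"
    have "q j \<noteq> p i"
    proof
      assume eq: "q j = p i"
      then have "j < i"
        using i(1,3) j(1) increasing_less_iff[OF q] by metis
      then show False
        using agree[OF _ j(2)] eq increasingD[OF p, of j i] i(1) by simp
    qed
    then show "q0 j = q1 j" by (simp add: q0_def q1_def)
  qed (use inc in auto)
  ultimately have "R p0 q1" by (rule trans)
  have "same_position n p0 q1 p1 q1"
    unfolding same_position_def
  proof (intro allI impI)
    fix j k
    show "(p0 j < q1 k \<longleftrightarrow> p1 j < q1 k) \<and> (q1 k < p0 j \<longleftrightarrow> q1 k < p1 j)"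
    proof (cases "j = i")
      case True
      consider "q k < p i" | "q k = p i" | "p i < q k" by linarith
      then show ?thesis
        using True by cases (simp_all add: p0_def p1_def q1_def)
    next
      case False
      then show ?thesis by (simp add: p1_def)
    qed
  qed
  then have "R p1 q1"
    using invariant inc \<open>R p0 q1\<close> by blast
  then have "R p0 p1" using \<open>R p0 q1\<close> sym trans by blast
  moreover have "p0 i \<noteq> 3 * p i" by (simp add: p0_def)
  ultimately have "free i"
    using inc(1,4) i(1) unfolding free_def p1_def by blast
  then show False using i(2) by simp
qed

theorem equivalent_iff_agree:
  assumes p: "increasing n p" and q: "increasing n q"
  shows "R p q \<longleftrightarrow> (\<forall>i\<in>{i. i < n \<and> \<not> free i}. p i = q i)"
proof
  assume R: "R p q"
  show "\<forall>i\<in>{i. i < n \<and> \<not> free i}. p i = q i"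
  proof (rule ccontr)
    let ?D = "\<lambda>i. i < n \<and> \<not> free i \<and> p i \<noteq> q i"
    assume "\<not> (\<forall>i\<in>{i. i < n \<and> \<not> free i}. p i = q i)"
    then have D: "\<exists>i. ?D i" by blast
    define i where "i = (LEAST i. ?D i)"
    have i: "?D i" using LeastI_ex[OF D] unfolding i_def .
    have agree: "p j = q j" if "j < i" "\<not> free j" for j
      using not_less_Least[of j ?D] that i unfolding i_def[symmetric] by auto
    consider "p i < q i" | "q i < p i" using i by linarith
    then show False
    proof cases
      case 1
      then show False using not_equivalent_if_less[OF p q, of i] i agree R by blast
    next
      case 2
      then show False using not_equivalent_if_less[OF q p, of i] i agree sym[OF R] by metis
    qed
  qed
next
  assume "\<forall>i\<in>{i. i < n \<and> \<not> free i}. p i = q i"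
  then show "R p q" using equivalent_if_agree[OF p q] by simp
qed

end

section \<open>Patterns of finite sets\<close>

definition pattern :: "nat \<Rightarrow> nat set set set \<Rightarrow> nat set \<Rightarrow> (nat set \<times> nat set) set" where
  "pattern m P s =
     {(A, B). A \<subseteq> {..<m} \<and> B \<subseteq> {..<m} \<and> same_part P (enumerate s ` A) (enumerate s ` B)}"

definition pattern_partition :: "nat \<Rightarrow> nat set set set \<Rightarrow> nat set set set" where
  "pattern_partition m P =
     (\<lambda>C. {s \<in> [UNIV]\<^bsup>m\<^esup>. pattern m P s = C}) ` Pow (Pow {..<m} \<times> Pow {..<m})"

lemma finite_pattern_partition: "finite (pattern_partition m P)"
  by (simp add: pattern_partition_def)

lemma weak_partition_on_pattern_partition:
  "weak_partition_on ([UNIV]\<^bsup>m\<^esup>) (pattern_partition m P)"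
proof -
  have "pattern m P s \<in> Pow (Pow {..<m} \<times> Pow {..<m})" for s
    by (auto simp: pattern_def)
  then have "\<Union> (pattern_partition m P) = [UNIV]\<^bsup>m\<^esup>"
    unfolding pattern_partition_def by blast
  moreover have "disjoint (pattern_partition m P)"
    by (auto simp: pattern_partition_def disjoint_def)
  ultimately show ?thesis by (simp add: weak_partition_on_def)
qed

lemma homogeneous_imp_pattern_eq:
  assumes "homogeneous_for m (pattern_partition m P) X" "s \<in> [X]\<^bsup>m\<^esup>" "t \<in> [X]\<^bsup>m\<^esup>"
  shows "pattern m P s = pattern m P t"
  using assms unfolding homogeneous_for_def pattern_partition_def by blast

text \<open>The new elements lie above \<open>U\<close> so that they do not influence the ranks of the old ones.\<close>

lemma end_extension_with_card:
  fixes X :: "nat set"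
  assumes "infinite X" "U \<subseteq> X" "finite U" "card U \<le> m"
  obtains s where "s \<in> [X]\<^bsup>m\<^esup>" "U \<subseteq> s"
    "\<And>u. u \<in> U \<Longrightarrow> {y \<in> s. y < u} = {y \<in> U. y < u}"
proof -
  obtain b where b: "\<And>u. u \<in> U \<Longrightarrow> u \<le> b"
    using assms(3) by (meson finite_nat_set_iff_bounded_le)
  have "infinite (X - {..b})" using assms(1) by simp
  then obtain T where T: "finite T" "card T = m - card U" "T \<subseteq> X - {..b}"
    using infinite_arbitrarily_large by blast
  have "U \<inter> T = {}" using T(3) b by auto
  then have "U \<union> T \<in> [X]\<^bsup>m\<^esup>"
    using T assms by (auto simp: nsets_def card_Un_disjoint)
  moreover have "{y \<in> U \<union> T. y < u} = {y \<in> U. y < u}" if "u \<in> U" for u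
    using T(3) b[OF that] by auto
  ultimately show thesis using that[of "U \<union> T"] by blast
qed

lemma card_below_in_union:
  assumes a: "increasing n a" and b: "increasing n b" and j: "j < n"
  shows "card {y \<in> a ` {..<n} \<union> b ` {..<n}. y < a j} =
     j + card {k. k < n \<and> b k < a j \<and> (\<forall>l<n. a l < b k \<or> b k < a l)}"
    (is "card ?L = j + card ?K")
proof -
  have "?L = a ` {..<j} \<union> b ` ?K"
  proof (intro equalityI subsetI)
    fix y assume y: "y \<in> ?L"
    show "y \<in> a ` {..<j} \<union> b ` ?K"
    proof (cases "y \<in> a ` {..<n}")
      case True
      then show ?thesis using y increasing_less_iff[OF a _ j] by auto
    next
      case False
      then obtain k where k: "k < n" "y = b k" using y by auto
      then have "k \<in> ?K" using y False by (force simp: neq_iff)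
      then show ?thesis using k by blast
    qed
  next
    fix y assume "y \<in> a ` {..<j} \<union> b ` ?K"
    then show "y \<in> ?L" using increasingD[OF a _ j] j by fastforce
  qed
  moreover have "a ` {..<j} \<inter> b ` ?K = {}"
  proof (rule equals0I)
    fix y assume "y \<in> a ` {..<j} \<inter> b ` ?K"
    then obtain k l where "l < j" "y = a l" "y = b k" "\<forall>l<n. a l < b k \<or> b k < a l"
      by blast
    then show False using j by (metis less_irrefl less_trans)
  qed
  moreover have "inj_on a {..<j}" "inj_on b ?K"
    using increasing_inj_on[OF a] increasing_inj_on[OF b] j
    by (auto elim!: inj_on_subset)
  ultimately show ?thesis
    by (simp add: card_Un_disjoint card_image)
qed

lemma same_position_card_below:
  assumes "increasing n a" "increasing n b" "increasing n a'" "increasing n b'"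
    and "same_position n a b a' b'" "j < n"
  shows "card {y \<in> a ` {..<n} \<union> b ` {..<n}. y < a j} =
     card {y \<in> a' ` {..<n} \<union> b' ` {..<n}. y < a' j}"
proof -
  have "{k. k < n \<and> b k < a j \<and> (\<forall>l<n. a l < b k \<or> b k < a l)} =
        {k. k < n \<and> b' k < a' j \<and> (\<forall>l<n. a' l < b' k \<or> b' k < a' l)}"
    using assms(5,6) unfolding same_position_def by blast
  then show ?thesis
    using card_below_in_union assms by simp
qed

text \<open>The pattern of a suitable \<open>2n\<close>-set decides whether the ranges of \<open>a\<close> and \<open>b\<close> are equivalent,
  at index sets that are given by ranks in the union of the two ranges only.\<close>

lemma same_part_iff_pattern:
  fixes X :: "nat set"
  assumes X: "infinite X" and U: "U = a ` {..<n} \<union> b ` {..<n}" and "U \<subseteq> X"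
  obtains s where "s \<in> [X]\<^bsup>(2 * n)\<^esup>"
    "same_part P (a ` {..<n}) (b ` {..<n}) \<longleftrightarrow>
       ((\<lambda>j. card {y \<in> U. y < a j}) ` {..<n}, (\<lambda>j. card {y \<in> U. y < b j}) ` {..<n})
         \<in> pattern (2 * n) P s"
proof -
  have "card U \<le> card (a ` {..<n}) + card (b ` {..<n})"
    unfolding U by (rule card_Un_le)
  also have "\<dots> \<le> 2 * n"
    using card_image_le[of "{..<n}" a] card_image_le[of "{..<n}" b] by simp
  finally have cU: "card U \<le> 2 * n" .
  have "finite U" by (simp add: U)
  then obtain s where s: "s \<in> [X]\<^bsup>(2 * n)\<^esup>" "U \<subseteq> s"
      and ranks: "\<And>u. u \<in> U \<Longrightarrow> {y \<in> s. y < u} = {y \<in> U. y < u}"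
    using end_extension_with_card[OF X assms(3) _ cU] by metis
  have fin: "finite s" and card: "card s = 2 * n" using s(1) by (auto simp: nsets_def)
  have rank_less: "card {y \<in> U. y < u} < 2 * n" if "u \<in> U" for u
  proof -
    have "{y \<in> s. y < u} \<subset> s" using that s(2) by blast
    then show ?thesis using psubset_card_mono[OF fin] card ranks[OF that] by metis
  qed
  have enum: "enumerate s (card {y \<in> U. y < u}) = u" if "u \<in> U" for u
    using enumerate_eq_iff_card_less[OF fin, of "card {y \<in> U. y < u}" u]
      rank_less[OF that] card ranks[OF that] s(2) that by auto
  have "enumerate s ` (\<lambda>j. card {y \<in> U. y < c j}) ` {..<n} = c ` {..<n}"
    if "c ` {..<n} \<subseteq> U" for c
    unfolding image_image using enum that by (intro image_cong) auto
  moreover have "(\<lambda>j. card {y \<in> U. y < c j}) ` {..<n} \<subseteq> {..<2 * n}"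
    if "c ` {..<n} \<subseteq> U" for c
    using rank_less that by blast
  ultimately show thesis
    using that[OF s(1)] U by (simp add: pattern_def)
qed

text \<open>Relative position fixes the ranks of both sequences in the union of their ranges, and hence the
  index sets at which the common pattern is to be consulted.\<close>

lemma homogeneous_imp_position_invariant:
  fixes X :: "nat set"
  assumes hom: "homogeneous_for (2 * n) (pattern_partition (2 * n) P) X" and X: "infinite X"
    and inc: "increasing n a" "increasing n b" "increasing n a'" "increasing n b'"
    and pos: "same_position n a b a' b'"
    and sub: "a ` {..<n} \<union> b ` {..<n} \<subseteq> X" "a' ` {..<n} \<union> b' ` {..<n} \<subseteq> X"
  shows "same_part P (a ` {..<n}) (b ` {..<n}) \<longleftrightarrow> same_part P (a' ` {..<n}) (b' ` {..<n})"
proof -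
  define U U' where "U = a ` {..<n} \<union> b ` {..<n}" and "U' = a' ` {..<n} \<union> b' ` {..<n}"
  have UX: "U \<subseteq> X" "U' \<subseteq> X" using sub by (simp_all add: U_def U'_def)
  have ranks_a: "(\<lambda>j. card {y \<in> U. y < a j}) ` {..<n} = (\<lambda>j. card {y \<in> U'. y < a' j}) ` {..<n}"
    using same_position_card_below[OF inc pos] unfolding U_def U'_def
    by (intro image_cong) auto
  have ranks_b: "(\<lambda>j. card {y \<in> U. y < b j}) ` {..<n} = (\<lambda>j. card {y \<in> U'. y < b' j}) ` {..<n}"
    using same_position_card_below[OF inc(2,1,4,3) same_position_swap[OF pos]]
    unfolding U_def U'_def Un_commute[of "a ` _"] Un_commute[of "a' ` _"]
    by (intro image_cong) auto
  obtain s where s: "s \<in> [X]\<^bsup>(2 * n)\<^esup>"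
    "same_part P (a ` {..<n}) (b ` {..<n}) \<longleftrightarrow>
       ((\<lambda>j. card {y \<in> U. y < a j}) ` {..<n}, (\<lambda>j. card {y \<in> U. y < b j}) ` {..<n})
         \<in> pattern (2 * n) P s"
    by (rule same_part_iff_pattern[OF X U_def UX(1), where P = P])
  obtain s' where s': "s' \<in> [X]\<^bsup>(2 * n)\<^esup>"
    "same_part P (a' ` {..<n}) (b' ` {..<n}) \<longleftrightarrow>
       ((\<lambda>j. card {y \<in> U'. y < a' j}) ` {..<n}, (\<lambda>j. card {y \<in> U'. y < b' j}) ` {..<n})
         \<in> pattern (2 * n) P s'"
    by (rule same_part_iff_pattern[OF X U'_def UX(2), where P = P])
  show ?thesis
    using s(2) s'(2) ranks_a ranks_b homogeneous_imp_pattern_eq[OF hom s(1) s'(1)] by simp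
qed

section \<open>Homogeneous sets are finite unions of canonical sets\<close>

lemma same_part_refl: "weak_partition_on Z P \<Longrightarrow> x \<in> Z \<Longrightarrow> same_part P x x"
  by (auto simp: weak_partition_on_def same_part_def)

lemma same_part_sym: "same_part P x y \<Longrightarrow> same_part P y x"
  by (auto simp: same_part_def)

lemma same_part_trans:
  "weak_partition_on Z P \<Longrightarrow> same_part P x y \<Longrightarrow> same_part P y z \<Longrightarrow> same_part P x z"
  unfolding weak_partition_on_def same_part_def disjoint_def by blast

lemma canonical_singleton:
  assumes "weak_partition_on ([UNIV]\<^bsup>n\<^esup>) P"
  shows "canonical n P {x}"
proof -
  have "p = q" if "p \<in> [{x}]\<^bsup>n\<^esup>" "q \<in> [{x}]\<^bsup>n\<^esup>" for p q
    using that by (auto simp: nsets_def subset_singleton_iff)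
  moreover have "same_part P p p" if "p \<in> [{x}]\<^bsup>n\<^esup>" for p
    using same_part_refl[OF assms] that by (auto simp: nsets_def)
  ultimately have "I_canonical n P {} {x}"
    unfolding I_canonical_def by force
  then show ?thesis
    unfolding canonical_def by blast
qed

text \<open>The enumeration of \<open>X\<close> transports the equivalence relation on \<open>n\<close>-subsets of \<open>X\<close> to increasing
  sequences of arbitrary natural numbers, where there is room for spreading out.\<close>

lemma canonical_if_homogeneous_infinite:
  fixes X :: "nat set"
  assumes P: "weak_partition_on ([UNIV]\<^bsup>n\<^esup>) P"
    and hom: "homogeneous_for (2 * n) (pattern_partition (2 * n) P) X"
    and X: "infinite X"
  shows "canonical n P X"
proof -
  define e where "e = enumerate X"
  have e_less: "e j < e k \<longleftrightarrow> j < k" for j k using X by (simp add: e_def)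
  have e_in: "e j \<in> X" for j using enumerate_in_set[OF X] by (simp add: e_def)
  have e_inj: "e j = e k \<longleftrightarrow> j = k" for j k using e_less by (metis linorder_neqE_nat less_irrefl)
  define R where "R a b = same_part P ((e \<circ> a) ` {..<n}) ((e \<circ> b) ` {..<n})" for a b
  have inc_e: "increasing n (e \<circ> a)" if "increasing n a" for a
    using that by (auto simp: strict_mono_on_def e_less)
  interpret position_invariant_equivalence n R
  proof
    fix a assume "increasing n a"
    then have "card ((e \<circ> a) ` {..<n}) = n"
      using card_image[OF increasing_inj_on[OF inc_e]] by simp
    then show "R a a"
      unfolding R_def by (intro same_part_refl[OF P]) (simp add: nsets_def)
  next
    fix a b assume "R a b"
    then show "R b a" unfolding R_def by (rule same_part_sym)
  next
    fix a b c assume "R a b" "R b c"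
    then show "R a c" unfolding R_def by (rule same_part_trans[OF P])
  next
    fix a b a' b'
    assume "increasing n a" "increasing n b" "increasing n a'" "increasing n b'"
      and pos: "same_position n a b a' b'" and "R a b"
    moreover have "same_position n (e \<circ> a) (e \<circ> b) (e \<circ> a') (e \<circ> b')"
      using pos by (simp add: same_position_def e_less)
    ultimately show "R a' b'"
      using homogeneous_imp_position_invariant[OF hom X, of "e \<circ> a" "e \<circ> b" "e \<circ> a'" "e \<circ> b'"]
        inc_e e_in unfolding R_def by auto
  qed
  have indices: "\<exists>a. increasing n a \<and> (e \<circ> a) ` {..<n} = p \<and> (\<forall>j<n. e (a j) = enumerate p j)"
    if p: "p \<in> [X]\<^bsup>n\<^esup>" for p
  proof -
    have fin: "finite p" and card: "card p = n" and "p \<subseteq> X" using p by (auto simp: nsets_def)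
    define a where "a j = (SOME k. e k = enumerate p j)" for j
    have ea: "e (a j) = enumerate p j" if "j < n" for j
    proof -
      have "enumerate p j \<in> X"
        using finite_enumerate_in_set[OF fin] that card \<open>p \<subseteq> X\<close> by blast
      then have "\<exists>k. e k = enumerate p j"
        using enumerate_Ex[of X] X unfolding e_def by metis
      then show ?thesis unfolding a_def by (rule someI_ex)
    qed
    have "increasing n a"
    proof (rule strict_mono_onI)
      fix j k assume jk: "j \<in> {..<n}" "k \<in> {..<n}" "j < k"
      then have "e (a j) < e (a k)"
        using finite_enumerate_mono[OF jk(3) fin] card by (simp add: ea)
      then show "a j < a k" by (simp add: e_less)
    qed
    moreover have "(e \<circ> a) ` {..<n} = p"
    proof -
      have "(e \<circ> a) ` {..<n} = enumerate p ` {..<n}"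
        using ea by (intro image_cong) auto
      also have "\<dots> = p"
        using finite_bij_enumerate[OF fin] card by (simp add: bij_betw_def)
      finally show ?thesis .
    qed
    ultimately show ?thesis using ea by blast
  qed
  have "I_canonical n P {i. i < n \<and> \<not> free i} X"
    unfolding I_canonical_def
  proof (intro ballI)
    fix p q assume p: "p \<in> [X]\<^bsup>n\<^esup>" and q: "q \<in> [X]\<^bsup>n\<^esup>"
    obtain a where
      a: "increasing n a" "(e \<circ> a) ` {..<n} = p" "\<forall>j<n. e (a j) = enumerate p j"
      using indices[OF p] by blast
    obtain b where
      b: "increasing n b" "(e \<circ> b) ` {..<n} = q" "\<forall>j<n. e (b j) = enumerate q j"
      using indices[OF q] by blast
    have eq: "a i = b i \<longleftrightarrow> enumerate p i = enumerate q i" if "i < n" for i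
      using e_inj[of "a i" "b i"] a(3) b(3) that by simp
    have "same_part P p q \<longleftrightarrow> R a b" by (simp only: R_def a(2) b(2))
    also have "\<dots> \<longleftrightarrow> (\<forall>i\<in>{i. i < n \<and> \<not> free i}. a i = b i)"
      by (rule equivalent_iff_agree[OF a(1) b(1)])
    also have "\<dots> \<longleftrightarrow> (\<forall>i\<in>{i. i < n \<and> \<not> free i}. enumerate p i = enumerate q i)"
      using eq by simp
    finally show "same_part P p q \<longleftrightarrow>
        (\<forall>i\<in>{i. i < n \<and> \<not> free i}. enumerate p i = enumerate q i)" .
  qed
  moreover have "{i. i < n \<and> \<not> free i} \<subseteq> {..<n}" by auto
  ultimately show ?thesis
    unfolding canonical_def by (intro exI conjI)
qed

theorem theorem1:
  fixes n :: nat and P :: "nat set set set"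
  assumes "n \<ge> 1"
    and "weak_partition_on ([UNIV]\<^bsup>n\<^esup>) P"
  shows "\<exists>Q :: nat set set set.
           finite Q \<and> weak_partition_on ([UNIV]\<^bsup>(2 * n)\<^esup>) Q \<and>
           (\<forall>X :: nat set. homogeneous_for (2 * n) Q X \<longrightarrow>
              (\<exists>F :: nat set set. finite F \<and> (\<forall>Y\<in>F. canonical n P Y) \<and> X = \<Union>F))"
proof (intro exI[of _ "pattern_partition (2 * n) P"] conjI allI impI)
  fix X assume hom: "homogeneous_for (2 * n) (pattern_partition (2 * n) P) X"
  show "\<exists>F :: nat set set. finite F \<and> (\<forall>Y\<in>F. canonical n P Y) \<and> X = \<Union>F"
  proof (cases "finite X")
    case True
    then show ?thesis
      using canonical_singleton[OF assms(2)]
      by (intro exI[of _ "(\<lambda>x. {x}) ` X"]) auto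
  next
    case False
    then show ?thesis
      using canonical_if_homogeneous_infinite[OF assms(2) hom]
      by (intro exI[of _ "{X}"]) auto
  qed
qed (rule finite_pattern_partition weak_partition_on_pattern_partition)+

end
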